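(* Every caterpillar has a tournament anti-Sidorenko (TAS) orientation.
   Context: A caterpillar is a finite (undirected) tree such that removing all its leaves results in a path. Weighted tournament: a function $A:[n]^2\to[0,1]$ with $A(x,y)+A(y,x)=1$ for all $x,y\in[n]$ (so $A(x,x)=1/2$). For a digraph $D$ with $v(D)$ vertices and $e(D)$ edges, $h_D(A)=\sum_{\phi:V(D)\to[n]}\prod_{(x,y)\in E(D)}A(\phi(x),\phi(y))$. A digraph $D$ is tournament anti-Sidorenko (TAS) if $h_D(A)\le n^{v(D)}/2^{e(D)}$ for every $n$ and every weighted tournament $A$ on $n$ vertices. An orientation of an undirected graph is a digraph obtained by choosing one direction for each edge. *)

theory Defs
  imports Complex_Main "HOL-Library.FuncSet" "Graph_Theory.Graph_Theory"
begin

text \<open>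
  Finite simple undirected graphs are the library's \<open>pair_graph\<close>s, in which every
  undirected edge is represented by its two arcs. Hence the library's \<open>forest\<close> (and so \<open>tree\<close>)
  is not usable for them: an edge followed by its reverse is already a \<open>cycle\<close>
  of length 2. For loop-free graphs without parallel arcs, the cycles of the
  undirected graph are the \<open>cycle\<close>s of length at least 3.
\<close>

definition undirected_tree :: "'a pair_pre_digraph \<Rightarrow> bool" where
  "undirected_tree G \<longleftrightarrow> pair_graph G \<and> connected G \<and>
     \<not> (\<exists>p. pre_digraph.cycle G p \<and> 3 \<le> length p)"

definition leaves :: "'a pair_pre_digraph \<Rightarrow> 'a set" where
  "leaves G = {v \<in> pverts G. out_degree G v = 1}"

text \<open>
  The list \<open>xs\<close> may be empty or a singleton: the null graph and the one-vertex graph count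
  as paths, so that a single edge and the stars are caterpillars.
\<close>

definition is_path_graph :: "('a, 'b) pre_digraph \<Rightarrow> bool" where
  "is_path_graph H \<longleftrightarrow> (\<exists>xs. distinct xs \<and> verts H = set xs \<and>
     arcs_ends H = set (vwalk_arcs xs) \<union> (set (vwalk_arcs xs))\<inverse>)"

definition caterpillar :: "'a pair_pre_digraph \<Rightarrow> bool" where
  "caterpillar G \<longleftrightarrow> undirected_tree G \<and>
     is_path_graph (with_proj G \<restriction> (pverts G - leaves G))"

definition is_orientation :: "'a pair_pre_digraph \<Rightarrow> 'a pair_pre_digraph \<Rightarrow> bool" where
  "is_orientation D G \<longleftrightarrow> pverts D = pverts G \<and> parcs D \<subseteq> parcs G \<and>
     (\<forall>(u, v) \<in> parcs G. ((u, v) \<in> parcs D) \<noteq> ((v, u) \<in> parcs D))"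

definition weighted_tournament :: "nat \<Rightarrow> (nat \<Rightarrow> nat \<Rightarrow> real) \<Rightarrow> bool" where
  "weighted_tournament n A \<longleftrightarrow>
     (\<forall>x \<in> {1..n}. \<forall>y \<in> {1..n}. A x y \<in> {0..1} \<and> A x y + A y x = 1)"

definition hom_sum :: "('a, 'b) pre_digraph \<Rightarrow> nat \<Rightarrow> (nat \<Rightarrow> nat \<Rightarrow> real) \<Rightarrow> real" where
  "hom_sum D n A =
     (\<Sum>\<phi> \<in> verts D \<rightarrow>\<^sub>E {1..n}. \<Prod>e \<in> arcs D. A (\<phi> (tail D e)) (\<phi> (head D e)))"

definition TAS :: "('a, 'b) pre_digraph \<Rightarrow> bool" where
  "TAS D \<longleftrightarrow> (\<forall>n A. weighted_tournament n A \<longrightarrow>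
     hom_sum D n A \<le> real n ^ card (verts D) / 2 ^ card (arcs D))"

end

theory Submission
  imports Defs "HOL-Analysis.Convex"
begin

text \<open>
  A caterpillar is grown by attaching a pendant vertex \<open>u\<close> to the current root \<open>r\<close>, after which
  either \<open>r\<close> stays the root (\<open>u\<close> is a leaf) or \<open>u\<close> becomes the root (\<open>u\<close> is the next spine vertex).
  Let \<open>F x\<close> be the weighted number of homomorphisms that send the root to \<open>x\<close>, let \<open>e\<close> be the number
  of edges, and let \<open>B\<close> be the tournament \<open>A\<close> or its transpose, with in-weights
  \<open>W x = (\<Sum>y. B y x)\<close>. The invariant is
  \<open>(\<Sum>x. F x) \<le> X\<close> and \<open>(\<Sum>x. W x * (F x)\<^sup>2) \<le> X\<^sup>2 / 2\<close> with \<open>X = n ^ (e + 1) / 2 ^ e\<close>.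
  The new edge is always oriented so that it contributes \<open>B\<close> evaluated at (\<open>u\<close>, \<open>r\<close>).

  If the root moves, \<open>F\<close> becomes \<open>B F\<close>, and
  \<open>((B F) x)\<^sup>2 \<le> (n - W x) * (\<Sum>y. B x y * (F y)\<^sup>2)\<close> by Cauchy--Schwarz. If the root stays, \<open>F\<close>
  becomes \<open>W F\<close>, and \<open>B\<close> is replaced by its transpose, whose in-weights are \<open>n - W\<close>. Both times the
  quadratic bound is preserved because \<open>W x * (n - W x) \<le> n\<^sup>2 / 4\<close>. In both cases the new sum is
  \<open>(\<Sum>x. W x * F x)\<close>, which Cauchy--Schwarz bounds using \<open>(\<Sum>x. W x) = n\<^sup>2 / 2\<close>.
\<close>

section \<open>Weighted bounds for rooted homomorphism functions\<close>

definition in_weight :: "nat \<Rightarrow> (nat \<Rightarrow> nat \<Rightarrow> real) \<Rightarrow> nat \<Rightarrow> real" where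
  "in_weight n B x = (\<Sum>y\<in>{1..n}. B y x)"

text \<open>A tree with \<open>e\<close> edges has \<open>Suc e\<close> vertices, so for its rooted
  homomorphism function the bound on the plain sum is the TAS inequality. The quadratic bound is the
  strengthening that lets the induction close.\<close>

definition root_bound :: "nat \<Rightarrow> (nat \<Rightarrow> nat \<Rightarrow> real) \<Rightarrow> nat \<Rightarrow> (nat \<Rightarrow> real) \<Rightarrow> bool" where
  "root_bound n B e F \<longleftrightarrow> (\<forall>x\<in>{1..n}. 0 \<le> F x) \<and>
     (\<Sum>x\<in>{1..n}. F x) \<le> real n ^ Suc e / 2 ^ e \<and>
     (\<Sum>x\<in>{1..n}. in_weight n B x * (F x)\<^sup>2) \<le> (real n ^ Suc e / 2 ^ e)\<^sup>2 / 2"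

text \<open>Cauchy--Schwarz for the vectors \<open>sqrt w\<close> and
  \<open>sqrt w * f\<close>.\<close>

lemma sum_mult_squared_le:
  fixes w f :: "'b \<Rightarrow> real"
  assumes "\<And>i. i \<in> I \<Longrightarrow> 0 \<le> w i"
  shows "(\<Sum>i\<in>I. w i * f i)\<^sup>2 \<le> (\<Sum>i\<in>I. w i) * (\<Sum>i\<in>I. w i * (f i)\<^sup>2)"
proof -
  have "(\<Sum>i\<in>I. sqrt (w i) * (sqrt (w i) * f i))\<^sup>2
      \<le> (\<Sum>i\<in>I. (sqrt (w i))\<^sup>2) * (\<Sum>i\<in>I. (sqrt (w i) * f i)\<^sup>2)"
    by (rule Cauchy_Schwarz_ineq_sum)
  moreover have "(\<Sum>i\<in>I. sqrt (w i) * (sqrt (w i) * f i)) = (\<Sum>i\<in>I. w i * f i)"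
    using assms by (intro sum.cong) (auto simp flip: mult.assoc)
  moreover have "(\<Sum>i\<in>I. (sqrt (w i))\<^sup>2) = (\<Sum>i\<in>I. w i)"
    using assms by (intro sum.cong) auto
  moreover have "(\<Sum>i\<in>I. (sqrt (w i) * f i)\<^sup>2) = (\<Sum>i\<in>I. w i * (f i)\<^sup>2)"
    using assms by (intro sum.cong) (auto simp: power_mult_distrib)
  ultimately show ?thesis by simp
qed

lemma weighted_tournament_transpose:
  "weighted_tournament n B \<Longrightarrow> weighted_tournament n (\<lambda>x y. B y x)"
  by (auto simp: weighted_tournament_def)

context
  fixes n :: nat and B :: "nat \<Rightarrow> nat \<Rightarrow> real"
  assumes wt: "weighted_tournament n B"
begin

lemma nonneg: "x \<in> {1..n} \<Longrightarrow> y \<in> {1..n} \<Longrightarrow> 0 \<le> B x y"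
  using wt by (auto simp: weighted_tournament_def)

lemma in_weight_nonneg: "x \<in> {1..n} \<Longrightarrow> 0 \<le> in_weight n B x"
  unfolding in_weight_def by (intro sum_nonneg nonneg)

lemma out_weight_conv:
  assumes "x \<in> {1..n}"
  shows "(\<Sum>y\<in>{1..n}. B x y) = real n - in_weight n B x"
proof -
  have "(\<Sum>y\<in>{1..n}. B x y) = (\<Sum>y\<in>{1..n}. 1 - B y x)"
    using assms wt by (intro sum.cong) (auto simp: weighted_tournament_def algebra_simps)
  then show ?thesis by (simp add: sum_subtractf in_weight_def)
qed

text \<open>Swapping the sums equates total in-weight and total out-weight, and the two add up to
  \<open>n * n\<close>.\<close>

lemma sum_in_weight: "(\<Sum>x\<in>{1..n}. in_weight n B x) = (real n)\<^sup>2 / 2"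
proof -
  have "(\<Sum>x\<in>{1..n}. in_weight n B x) = (\<Sum>x\<in>{1..n}. \<Sum>y\<in>{1..n}. B x y)"
    unfolding in_weight_def by (rule sum.swap)
  also have "\<dots> = (\<Sum>x\<in>{1..n}. real n - in_weight n B x)"
    by (intro sum.cong out_weight_conv) auto
  finally show ?thesis by (simp add: sum_subtractf power2_eq_square)
qed

lemma in_weight_complement_le: "(real n - in_weight n B x) * in_weight n B x \<le> (real n)\<^sup>2 / 4"
  using zero_le_power2[of "real n - 2 * in_weight n B x"]
  by (simp add: power2_eq_square algebra_simps)

lemma sum_in_weight_mult_le:
  assumes "root_bound n B e F"
  shows "(\<Sum>x\<in>{1..n}. in_weight n B x * F x) \<le> real n ^ Suc (Suc e) / 2 ^ Suc e"
proof -
  let ?X = "real n ^ Suc e / 2 ^ e"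
  have "(\<Sum>x\<in>{1..n}. in_weight n B x * F x)\<^sup>2
      \<le> (\<Sum>x\<in>{1..n}. in_weight n B x) * (\<Sum>x\<in>{1..n}. in_weight n B x * (F x)\<^sup>2)"
    by (intro sum_mult_squared_le in_weight_nonneg)
  also have "\<dots> \<le> (real n)\<^sup>2 / 2 * (?X\<^sup>2 / 2)"
    using assms unfolding sum_in_weight root_bound_def by (intro mult_left_mono) auto
  \<comment> \<open>One more edge multiplies \<open>?X\<close> by \<open>n / 2\<close>, and the
    product above is exactly the square of \<open>n * ?X / 2\<close>.\<close>
  also have "\<dots> = (real n ^ Suc (Suc e) / 2 ^ Suc e)\<^sup>2"
    by (simp add: power2_eq_square)
  finally show ?thesis by (rule power2_le_imp_le) simp
qed

text \<open>Both bounds are equalities here: \<open>X = n\<close>, and the total in-weight is half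
  its square.\<close>

lemma root_bound_single: "root_bound n B 0 (\<lambda>_. 1)"
  by (simp add: root_bound_def sum_in_weight del: One_nat_def)

text \<open>Transposing \<open>B\<close> supplies the weight \<open>n - W\<close>, so that one
  factor \<open>W\<close> of \<open>(W * F)\<^sup>2\<close> completes the product
  \<open>(n - W) * W\<close> and the other restores the old quadratic sum.\<close>

lemma root_bound_leaf:
  assumes "root_bound n B e F"
  shows "root_bound n (\<lambda>x y. B y x) (Suc e) (\<lambda>x. in_weight n B x * F x)"
proof -
  let ?W = "in_weight n B" and ?X = "real n ^ Suc e / 2 ^ e"
  have "(\<Sum>x\<in>{1..n}. in_weight n (\<lambda>x y. B y x) x * (?W x * F x)\<^sup>2)
      = (\<Sum>x\<in>{1..n}. (real n - ?W x) * ?W x * (?W x * (F x)\<^sup>2))"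
    by (intro sum.cong refl)
      (simp add: in_weight_def[of n "\<lambda>x y. B y x"] out_weight_conv power2_eq_square
        del: One_nat_def)
  also have "\<dots> \<le> (\<Sum>x\<in>{1..n}. (real n)\<^sup>2 / 4 * (?W x * (F x)\<^sup>2))"
    by (intro sum_mono mult_right_mono in_weight_complement_le mult_nonneg_nonneg
        in_weight_nonneg) auto
  also have "\<dots> = (real n)\<^sup>2 / 4 * (\<Sum>x\<in>{1..n}. ?W x * (F x)\<^sup>2)"
    by (simp add: sum_distrib_left)
  also have "\<dots> \<le> (real n)\<^sup>2 / 4 * (?X\<^sup>2 / 2)"
    using assms unfolding root_bound_def by (intro mult_left_mono) auto
  also have "\<dots> = (real n ^ Suc (Suc e) / 2 ^ Suc e)\<^sup>2 / 2"
    by (simp add: power2_eq_square)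
  finally show ?thesis
    using assms sum_in_weight_mult_le[OF assms] in_weight_nonneg by (auto simp: root_bound_def)
qed

text \<open>Here \<open>B\<close> stays fixed: the factor \<open>n - W x\<close> is the total weight
  of the row \<open>B x\<close> in Cauchy--Schwarz, and summing the rows over \<open>x\<close>
  yields the in-weights of \<open>y\<close> again.\<close>

lemma root_bound_move:
  assumes "root_bound n B e F"
  shows "root_bound n B (Suc e) (\<lambda>x. \<Sum>y\<in>{1..n}. B x y * F y)"
proof -
  let ?W = "in_weight n B" and ?X = "real n ^ Suc e / 2 ^ e"
  have "(\<Sum>x\<in>{1..n}. ?W x * (\<Sum>y\<in>{1..n}. B x y * F y)\<^sup>2)
      \<le> (\<Sum>x\<in>{1..n}. ?W x * ((real n - ?W x) * (\<Sum>y\<in>{1..n}. B x y * (F y)\<^sup>2)))"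
  proof (intro sum_mono mult_left_mono in_weight_nonneg)
    fix x assume x: "x \<in> {1..n}"
    show "(\<Sum>y\<in>{1..n}. B x y * F y)\<^sup>2
        \<le> (real n - ?W x) * (\<Sum>y\<in>{1..n}. B x y * (F y)\<^sup>2)"
      using sum_mult_squared_le[of "{1..n}" "B x" F] x
      by (simp add: nonneg out_weight_conv del: One_nat_def)
  qed
  also have "\<dots> \<le> (\<Sum>x\<in>{1..n}. (real n)\<^sup>2 / 4 * (\<Sum>y\<in>{1..n}. B x y * (F y)\<^sup>2))"
  proof (intro sum_mono)
    fix x assume x: "x \<in> {1..n}"
    have "(real n - ?W x) * ?W x * (\<Sum>y\<in>{1..n}. B x y * (F y)\<^sup>2)
        \<le> (real n)\<^sup>2 / 4 * (\<Sum>y\<in>{1..n}. B x y * (F y)\<^sup>2)"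
      using x by (intro mult_right_mono in_weight_complement_le sum_nonneg mult_nonneg_nonneg
          nonneg) auto
    then show "?W x * ((real n - ?W x) * (\<Sum>y\<in>{1..n}. B x y * (F y)\<^sup>2))
        \<le> (real n)\<^sup>2 / 4 * (\<Sum>y\<in>{1..n}. B x y * (F y)\<^sup>2)"
      by (simp only: mult_ac)
  qed
  also have "\<dots> = (real n)\<^sup>2 / 4 * (\<Sum>x\<in>{1..n}. \<Sum>y\<in>{1..n}. B x y * (F y)\<^sup>2)"
    by (simp add: sum_distrib_left)
  also have "(\<Sum>x\<in>{1..n}. \<Sum>y\<in>{1..n}. B x y * (F y)\<^sup>2) = (\<Sum>y\<in>{1..n}. ?W y * (F y)\<^sup>2)"
    unfolding in_weight_def sum_distrib_right by (rule sum.swap)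
  also have "(real n)\<^sup>2 / 4 * \<dots> \<le> (real n)\<^sup>2 / 4 * (?X\<^sup>2 / 2)"
    using assms unfolding root_bound_def by (intro mult_left_mono) auto
  also have "\<dots> = (real n ^ Suc (Suc e) / 2 ^ Suc e)\<^sup>2 / 2"
    by (simp add: power2_eq_square)
  finally have 1: "(\<Sum>x\<in>{1..n}. ?W x * (\<Sum>y\<in>{1..n}. B x y * F y)\<^sup>2)
      \<le> (real n ^ Suc (Suc e) / 2 ^ Suc e)\<^sup>2 / 2" .
  have "(\<Sum>x\<in>{1..n}. \<Sum>y\<in>{1..n}. B x y * F y) = (\<Sum>y\<in>{1..n}. ?W y * F y)"
    unfolding in_weight_def sum_distrib_right by (rule sum.swap)
  then have 2: "(\<Sum>x\<in>{1..n}. \<Sum>y\<in>{1..n}. B x y * F y) \<le> real n ^ Suc (Suc e) / 2 ^ Suc e"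
    using sum_in_weight_mult_le[OF assms] by simp
  have 3: "0 \<le> (\<Sum>y\<in>{1..n}. B x y * F y)" if "x \<in> {1..n}" for x
    using assms that by (intro sum_nonneg mult_nonneg_nonneg nonneg) (auto simp: root_bound_def)
  show ?thesis
    unfolding root_bound_def using 1 2 3 by blast
qed

end

section \<open>Attaching a pendant vertex to a rooted digraph\<close>

definition rooted_hom ::
    "'a set \<Rightarrow> 'a rel \<Rightarrow> 'a \<Rightarrow> nat \<Rightarrow> (nat \<Rightarrow> nat \<Rightarrow> real) \<Rightarrow> nat \<Rightarrow> real" where
  "rooted_hom V D r n A x =
     (\<Sum>\<phi> | \<phi> \<in> V \<rightarrow>\<^sub>E {1..n} \<and> \<phi> r = x. \<Prod>e\<in>D. A (\<phi> (fst e)) (\<phi> (snd e)))"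

text \<open>Maps are grouped by the image of the root. The weight \<open>h\<close> is constant on
  each group; \<open>h = 1\<close> gives the full homomorphism sum.\<close>

lemma sum_rooted_hom:
  assumes "finite V" "r \<in> V"
  shows "(\<Sum>\<phi>\<in>V \<rightarrow>\<^sub>E {1..n}. h (\<phi> r) * (\<Prod>e\<in>D. A (\<phi> (fst e)) (\<phi> (snd e))))
    = (\<Sum>x\<in>{1..n}. h x * rooted_hom V D r n A x)"
proof -
  have "(\<Sum>\<phi>\<in>V \<rightarrow>\<^sub>E {1..n}. h (\<phi> r) * (\<Prod>e\<in>D. A (\<phi> (fst e)) (\<phi> (snd e))))
    = (\<Sum>x\<in>{1..n}. \<Sum>\<phi> | \<phi> \<in> V \<rightarrow>\<^sub>E {1..n} \<and> \<phi> r = x.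
        h (\<phi> r) * (\<Prod>e\<in>D. A (\<phi> (fst e)) (\<phi> (snd e))))"
    using assms by (intro sum.group[symmetric] finite_PiE) (auto simp: PiE_iff)
  then show ?thesis
    by (simp add: rooted_hom_def sum_distrib_left)
qed

text \<open>The flag \<open>s\<close> records whether the next edge is read in \<open>A\<close> or in its transpose.\<close>

definition orient :: "bool \<Rightarrow> (nat \<Rightarrow> nat \<Rightarrow> real) \<Rightarrow> nat \<Rightarrow> nat \<Rightarrow> real" where
  "orient s A = (if s then A else (\<lambda>x y. A y x))"

text \<open>Matched to \<open>orient\<close>: for either flag this arc contributes
  \<open>orient s A (\<phi> u) (\<phi> r)\<close>.\<close>

definition pendant_arc :: "bool \<Rightarrow> 'a \<Rightarrow> 'a \<Rightarrow> 'a \<times> 'a" where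
  "pendant_arc s u r = (if s then (u, r) else (r, u))"

context
  fixes V :: "'a set" and D :: "'a rel" and r u :: 'a
  assumes V: "finite V" "r \<in> V" and D: "D \<subseteq> V \<times> V" and u: "u \<notin> V"
begin

text \<open>A map on \<open>insert u V\<close> is a map on \<open>V\<close> plus a free value at
  \<open>u\<close>, and only the new arc sees that value. Taking for \<open>h\<close> an indicator
  of the image of \<open>r\<close> or of \<open>u\<close> gives the two recurrences below.\<close>

lemma sum_insert_pendant:
  "(\<Sum>\<phi>\<in>insert u V \<rightarrow>\<^sub>E {1..n}. h (\<phi> u) (\<phi> r) *
      (\<Prod>e\<in>insert (pendant_arc s u r) D. A (\<phi> (fst e)) (\<phi> (snd e))))
   = (\<Sum>x\<in>{1..n}. \<Sum>y\<in>{1..n}. h y x * orient s A y x * rooted_hom V D r n A x)"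
proof -
  let ?P = "\<lambda>D \<phi>. \<Prod>e\<in>D. A (\<phi> (fst e)) (\<phi> (snd e))"
  let ?e = "pendant_arc s u r"
  have fin: "finite D" using D V finite_subset by blast
  have new: "?e \<notin> D" using u D by (auto simp: pendant_arc_def)
  have ne: "r \<noteq> u" using u V by auto
  have upd: "?P (insert ?e D) (\<phi>(u := y)) = orient s A y (\<phi> r) * ?P D \<phi>" for \<phi> y
  proof -
    have "?P D (\<phi>(u := y)) = ?P D \<phi>"
      using D u by (intro prod.cong) auto
    then show ?thesis
      using fin new ne by (auto simp: pendant_arc_def orient_def)
  qed
  have "(\<Sum>\<phi>\<in>insert u V \<rightarrow>\<^sub>E {1..n}. h (\<phi> u) (\<phi> r) * ?P (insert ?e D) \<phi>)
      = (\<Sum>(y, \<phi>)\<in>{1..n} \<times> (V \<rightarrow>\<^sub>E {1..n}). h y (\<phi> r) * (orient s A y (\<phi> r) * ?P D \<phi>))"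
    unfolding PiE_insert_eq using ne u
    by (subst sum.reindex[OF inj_combinator]) (auto simp: upd fun_upd_same fun_upd_other[OF ne] simp del: fun_upd_apply intro!: sum.cong)
  also have "\<dots> = (\<Sum>y\<in>{1..n}. \<Sum>\<phi>\<in>V \<rightarrow>\<^sub>E {1..n}. h y (\<phi> r) * orient s A y (\<phi> r) * ?P D \<phi>)"
    by (simp add: sum.cartesian_product mult.assoc)
  also have "\<dots> = (\<Sum>y\<in>{1..n}. \<Sum>x\<in>{1..n}. h y x * orient s A y x * rooted_hom V D r n A x)"
    by (intro sum.cong refl sum_rooted_hom[OF V])
  also have "\<dots> = (\<Sum>x\<in>{1..n}. \<Sum>y\<in>{1..n}. h y x * orient s A y x * rooted_hom V D r n A x)"
    by (rule sum.swap)
  finally show ?thesis .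
qed

lemma rooted_hom_leaf:
  assumes "z \<in> {1..n}"
  shows "rooted_hom (insert u V) (insert (pendant_arc s u r) D) r n A z
    = in_weight n (orient s A) z * rooted_hom V D r n A z"
proof -
  have "rooted_hom (insert u V) (insert (pendant_arc s u r) D) r n A z
    = (\<Sum>\<phi>\<in>insert u V \<rightarrow>\<^sub>E {1..n}. of_bool (\<phi> r = z) *
        (\<Prod>e\<in>insert (pendant_arc s u r) D. A (\<phi> (fst e)) (\<phi> (snd e))))"
    unfolding rooted_hom_def using V
    by (intro sum.mono_neutral_cong_left finite_PiE) auto
  also have "\<dots> = (\<Sum>x\<in>{1..n}. \<Sum>y\<in>{1..n}.
      of_bool (x = z) * orient s A y x * rooted_hom V D r n A x)"
    by (rule sum_insert_pendant)
  also have "\<dots> = (\<Sum>x\<in>{1..n}. if x = z then in_weight n (orient s A) z * rooted_hom V D r n A z else 0)"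
    by (intro sum.cong) (auto simp: in_weight_def sum_distrib_right)
  finally show ?thesis using assms by simp
qed

lemma rooted_hom_move:
  assumes "z \<in> {1..n}"
  shows "rooted_hom (insert u V) (insert (pendant_arc s u r) D) u n A z
    = (\<Sum>x\<in>{1..n}. orient s A z x * rooted_hom V D r n A x)"
proof -
  have "rooted_hom (insert u V) (insert (pendant_arc s u r) D) u n A z
    = (\<Sum>\<phi>\<in>insert u V \<rightarrow>\<^sub>E {1..n}. of_bool (\<phi> u = z) *
        (\<Prod>e\<in>insert (pendant_arc s u r) D. A (\<phi> (fst e)) (\<phi> (snd e))))"
    unfolding rooted_hom_def using V
    by (intro sum.mono_neutral_cong_left finite_PiE) auto
  also have "\<dots> = (\<Sum>x\<in>{1..n}. \<Sum>y\<in>{1..n}.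
      of_bool (y = z) * orient s A y x * rooted_hom V D r n A x)"
    by (rule sum_insert_pendant)
  also have "\<dots> = (\<Sum>x\<in>{1..n}. \<Sum>y\<in>{1..n}.
      if y = z then orient s A z x * rooted_hom V D r n A x else 0)"
    by (intro sum.cong) auto
  finally show ?thesis using assms by simp
qed

end

section \<open>Growing caterpillars from a root\<close>

inductive grown :: "'a set \<Rightarrow> 'a rel \<Rightarrow> 'a \<Rightarrow> bool" where
  single: "grown {r} {} r"
| leaf: "grown V E r \<Longrightarrow> u \<notin> V \<Longrightarrow> grown (insert u V) (E \<union> {(u, r), (r, u)}) r"
| move: "grown V E r \<Longrightarrow> u \<notin> V \<Longrightarrow> grown (insert u V) (E \<union> {(u, r), (r, u)}) u"

lemma grown_wf:
  assumes "grown V E r"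
  shows "finite V" "r \<in> V" "E \<subseteq> V \<times> V"
  using assms by (induction, auto)

section \<open>Orientations of grown trees\<close>

lemma root_bound_cong:
  assumes "root_bound n B e F" "\<And>x. x \<in> {1..n} \<Longrightarrow> F x = F' x"
  shows "root_bound n B e F'"
proof -
  have "(\<Sum>x\<in>{1..n}. F x) = (\<Sum>x\<in>{1..n}. F' x)"
    "(\<Sum>x\<in>{1..n}. in_weight n B x * (F x)\<^sup>2) = (\<Sum>x\<in>{1..n}. in_weight n B x * (F' x)\<^sup>2)"
    using assms(2) by (simp_all cong: sum.cong_simp del: One_nat_def)
  then show ?thesis using assms unfolding root_bound_def by auto
qed

text \<open>Both \<open>s\<close> and \<open>D\<close> are fixed before \<open>n\<close> and
  \<open>A\<close>, since one orientation must serve all tournaments. The cardinality condition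
  turns the exponent \<open>Suc (card D)\<close> into the number of vertices.\<close>

definition good_orientation :: "bool \<Rightarrow> 'a set \<Rightarrow> 'a rel \<Rightarrow> 'a \<Rightarrow> 'a rel \<Rightarrow> bool" where
  "good_orientation s V E r D \<longleftrightarrow> D \<subseteq> E \<and> (\<forall>(u, v)\<in>E. ((u, v) \<in> D) \<noteq> ((v, u) \<in> D)) \<and>
     card V = Suc (card D) \<and>
     (\<forall>n A. weighted_tournament n A \<longrightarrow>
        root_bound n (orient s A) (card D) (rooted_hom V D r n A))"

lemma weighted_tournament_orient: "weighted_tournament n A \<Longrightarrow> weighted_tournament n (orient s A)"
  by (simp add: orient_def weighted_tournament_transpose)

lemma orient_flip: "orient (\<not> s) A = (\<lambda>x y. orient s A y x)"
  by (simp add: orient_def)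

text \<open>Both growth steps add the same arc; they differ only in the new root and in whether the
  flag flips.\<close>

lemma good_orientation_insert:
  assumes V: "finite V" "r \<in> V" "E \<subseteq> V \<times> V" "u \<notin> V"
    and good: "good_orientation s V E r D"
  shows "good_orientation (\<not> s) (insert u V) (E \<union> {(u, r), (r, u)}) r (insert (pendant_arc s u r) D)"
    and "good_orientation s (insert u V) (E \<union> {(u, r), (r, u)}) u (insert (pendant_arc s u r) D)"
proof -
  let ?D = "insert (pendant_arc s u r) D"
  have D: "D \<subseteq> V \<times> V" "D \<subseteq> E" using good V by (auto simp: good_orientation_def)
  have new: "pendant_arc s u r \<notin> D" using D V by (auto simp: pendant_arc_def)
  have card_D: "card ?D = Suc (card D)"
    using new D V finite_subset[of D "V \<times> V"] by simp
  have card_V: "card (insert u V) = Suc (card ?D)"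
    using good V card_D by (simp add: good_orientation_def)
  have sub: "?D \<subseteq> E \<union> {(u, r), (r, u)}"
    using D by (auto simp: pendant_arc_def)
  have xor: "\<forall>(v, w)\<in>E \<union> {(u, r), (r, u)}. ((v, w) \<in> ?D) \<noteq> ((w, v) \<in> ?D)"
  proof (clarify)
    fix v w assume vw: "(v, w) \<in> E \<union> {(u, r), (r, u)}" and eq: "((v, w) \<in> ?D) = ((w, v) \<in> ?D)"
    show False
    \<comment> \<open>Old edges avoid \<open>u\<close>, so the new arc does not affect them; on the
      new edge, \<open>D\<close> has neither direction.\<close>
    proof (cases "(v, w) \<in> E")
      case True
      then have "v \<noteq> u" "w \<noteq> u" using V by auto
      then have "((v, w) \<in> D) = ((w, v) \<in> D)" using eq by (auto simp: pendant_arc_def)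
      then show False using good True by (auto simp: good_orientation_def)
    next
      case False
      have "(u, r) \<notin> D" "(r, u) \<notin> D" "u \<noteq> r" using D V by auto
      then show False using False vw eq by (auto simp: pendant_arc_def split: if_splits)
    qed
  qed
  have bd: "root_bound n (orient s A) (card D) (rooted_hom V D r n A)"
    if "weighted_tournament n A" for n A
    using good that by (auto simp: good_orientation_def)
  have "root_bound n (orient (\<not> s) A) (card ?D) (rooted_hom (insert u V) ?D r n A)"
    if "weighted_tournament n A" for n A
    unfolding card_D orient_flip
    by (rule root_bound_cong[OF root_bound_leaf[OF weighted_tournament_orient[OF that] bd[OF that]]])
      (use V D in \<open>simp add: rooted_hom_leaf\<close>)
  then show "good_orientation (\<not> s) (insert u V) (E \<union> {(u, r), (r, u)}) r ?D"
    using card_V sub xor by (simp add: good_orientation_def)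
  have "root_bound n (orient s A) (card ?D) (rooted_hom (insert u V) ?D u n A)"
    if "weighted_tournament n A" for n A
    unfolding card_D
    by (rule root_bound_cong[OF root_bound_move[OF weighted_tournament_orient[OF that] bd[OF that]]])
      (use V D in \<open>simp add: rooted_hom_move\<close>)
  then show "good_orientation s (insert u V) (E \<union> {(u, r), (r, u)}) u ?D"
    using card_V sub xor by (simp add: good_orientation_def)
qed

lemma rooted_hom_single:
  assumes "z \<in> {1..n}"
  shows "rooted_hom {r} {} r n A z = 1"
proof -
  \<comment> \<open>Extensional maps are \<open>undefined\<close> off \<open>r\<close>, so exactly
    one map sends \<open>r\<close> to \<open>z\<close>; its product is empty.\<close>
  have "{\<phi>. \<phi> \<in> {r} \<rightarrow>\<^sub>E {1..n} \<and> \<phi> r = z} = {\<lambda>x. if x = r then z else undefined}"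
    using assms by (auto simp: PiE_iff extensional_def fun_eq_iff)
  then show ?thesis by (simp add: rooted_hom_def)
qed

lemma grown_good_orientation: "grown V E r \<Longrightarrow> \<exists>s D. good_orientation s V E r D"
proof (induction rule: grown.induct)
  case (single r)
  have "root_bound n (orient True A) 0 (rooted_hom {r} {} r n A)"
    if "weighted_tournament n A" for n A
    by (rule root_bound_cong[OF root_bound_single[OF weighted_tournament_orient[OF that]]])
      (simp add: rooted_hom_single)
  then have "good_orientation True {r} {} r {}"
    by (simp add: good_orientation_def)
  then show ?case by blast
next
  case (leaf V E r u)
  then show ?case using good_orientation_insert(1) grown_wf by metis
next
  case (move V E r u)
  then show ?case using good_orientation_insert(2) grown_wf by metis
qed

lemma grown_TAS_orientation:
  assumes "grown (pverts G) (parcs G) r"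
  shows "\<exists>D. is_orientation D G \<and> TAS (with_proj D)"
proof -
  obtain s D where good: "good_orientation s (pverts G) (parcs G) r D"
    using grown_good_orientation[OF assms] by blast
  let ?D = "\<lparr>pverts = pverts G, parcs = D\<rparr>"
  have "is_orientation ?D G"
    using good by (auto simp: is_orientation_def good_orientation_def)
  moreover have "hom_sum (with_proj ?D) n A \<le> real n ^ card (pverts G) / 2 ^ card D"
    if "weighted_tournament n A" for n A
  proof -
    have "hom_sum (with_proj ?D) n A = (\<Sum>x\<in>{1..n}. rooted_hom (pverts G) D r n A x)"
      using sum_rooted_hom[OF grown_wf(1,2)[OF assms], where h = "\<lambda>_. 1"]
      by (simp add: hom_sum_def)
    then show ?thesis
      using good that by (auto simp: good_orientation_def root_bound_def)
  qed
  ultimately show ?thesis by (auto simp: TAS_def)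
qed

section \<open>Growing a spine together with its leaves\<close>

lemma grown_leaves:
  assumes "grown V E r" "finite L" "L \<inter> V = {}"
  shows "grown (V \<union> L) (E \<union> L \<times> {r} \<union> {r} \<times> L) r"
  using assms(2,3)
proof (induction L rule: finite_induct)
  case empty
  then show ?case using assms(1) by simp
next
  case (insert u L)
  then have "grown (insert u (V \<union> L)) ((E \<union> L \<times> {r} \<union> {r} \<times> L) \<union> {(u, r), (r, u)}) r"
    by (intro grown.leaf) auto
  also have "insert u (V \<union> L) = V \<union> insert u L" by auto
  also have "(E \<union> L \<times> {r} \<union> {r} \<times> L) \<union> {(u, r), (r, u)}
      = E \<union> insert u L \<times> {r} \<union> {r} \<times> insert u L" by auto
  finally show ?case .
qed

lemma vwalk_arcs_snoc:
  "xs \<noteq> [] \<Longrightarrow> vwalk_arcs (xs @ [x]) = vwalk_arcs xs @ [(last xs, x)]"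
  by (induction xs rule: vwalk_arcs.induct) auto

text \<open>A vertex receives leaves only while it is the root. Hence the induction from the right:
  grow \<open>xs\<close> with its own leaves, move the root to \<open>x\<close>, then attach the
  leaves of \<open>x\<close>, collected in \<open>K\<close>.\<close>

lemma grown_spine:
  assumes "xs \<noteq> []" "distinct xs" "finite L" "L \<inter> set xs = {}" "p ` L \<subseteq> set xs"
  shows "grown (set xs \<union> L)
    (set (vwalk_arcs xs) \<union> (set (vwalk_arcs xs))\<inverse> \<union> {(l, p l) |l. l \<in> L} \<union> {(p l, l) |l. l \<in> L})
    (last xs)"
  using assms
proof (induction xs arbitrary: L rule: rev_nonempty_induct)
  case (single x)
  then have "grown ({x} \<union> L) ({} \<union> L \<times> {x} \<union> {x} \<times> L) x"
    by (intro grown_leaves grown.single) auto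
  also have "{} \<union> L \<times> {x} \<union> {x} \<times> L = {(l, p l) |l. l \<in> L} \<union> {(p l, l) |l. l \<in> L}"
    using single by auto
  finally show ?case by simp
next
  case (snoc x xs)
  define K where "K = {l \<in> L. p l = x}"
  let ?E = "\<lambda>xs L. set (vwalk_arcs xs) \<union> (set (vwalk_arcs xs))\<inverse>
    \<union> {(l, p l) |l. l \<in> L} \<union> {(p l, l) |l. l \<in> L}"
  have "grown (set xs \<union> (L - K)) (?E xs (L - K)) (last xs)"
    using snoc.prems by (intro snoc.IH) (auto simp: K_def)
  then have "grown (insert x (set xs \<union> (L - K)))
      (?E xs (L - K) \<union> {(x, last xs), (last xs, x)}) x"
    using snoc.prems by (intro grown.move) auto
  then have "grown (insert x (set xs \<union> (L - K)) \<union> K)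
      (?E xs (L - K) \<union> {(x, last xs), (last xs, x)} \<union> K \<times> {x} \<union> {x} \<times> K) x"
    using snoc.prems by (intro grown_leaves) (auto simp: K_def)
  also have "insert x (set xs \<union> (L - K)) \<union> K = set (xs @ [x]) \<union> L"
    by (auto simp: K_def)
  also have "?E xs (L - K) \<union> {(x, last xs), (last xs, x)} \<union> K \<times> {x} \<union> {x} \<times> K = ?E (xs @ [x]) L"
    using snoc.hyps by (auto simp: vwalk_arcs_snoc K_def)
  finally show ?case by simp
qed

section \<open>Caterpillars\<close>

text \<open>Walks starting in \<open>S\<close> stay in \<open>S\<close>, and connectedness lets them
  reach every vertex.\<close>

lemma connected_closed_subset:
  assumes "pair_graph G" "connected (with_proj G)" "S \<subseteq> pverts G" "S \<noteq> {}"
    and closed: "\<And>u v. (u, v) \<in> parcs G \<Longrightarrow> u \<in> S \<Longrightarrow> v \<in> S"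
  shows "S = pverts G"
proof -
  interpret pair_graph G by fact
  obtain a where a: "a \<in> S" using assms(4) by blast
  have "v \<in> S" if "v \<in> pverts G" for v
  proof -
    have "(a, v) \<in> rtrancl_on (pverts G) ((parcs G)\<^sup>s)"
      using assms a that by (auto simp: connected_conv)
    moreover have "(parcs G)\<^sup>s = parcs G"
      using pair_sym_arcs by (auto simp: symmetric_def symcl_def sym_def)
    ultimately have "(a, v) \<in> rtrancl_on (pverts G) (parcs G)" by simp
    then show ?thesis
      by (induction rule: rtrancl_on_induct) (use a closed in auto)
  qed
  then show ?thesis using assms(3) by blast
qed

text \<open>Every leaf \<open>l\<close> has a unique neighbour \<open>p l\<close>. If some
  \<open>p l\<close> is itself a leaf, the graph is a single edge with empty spine, treated apart;
  otherwise all leaves hang on the spine \<open>xs\<close> and \<open>grown_spine\<close>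
  applies.\<close>

lemma caterpillar_grown:
  assumes "caterpillar G"
  shows "\<exists>r. grown (pverts G) (parcs G) r"
proof -
  have pg: "pair_graph G" and conn: "connected (with_proj G)"
    using assms by (auto simp: caterpillar_def undirected_tree_def)
  interpret pair_graph G by fact
  let ?L = "leaves G"
  obtain xs where xs: "distinct xs" "set xs = pverts G - ?L"
    and arcs_xs: "{(u, v) \<in> parcs G. u \<notin> ?L \<and> v \<notin> ?L} = set (vwalk_arcs xs) \<union> (set (vwalk_arcs xs))\<inverse>"
  proof -
    have "arcs_ends (with_proj G \<restriction> (pverts G - ?L)) = {(u, v) \<in> parcs G. u \<notin> ?L \<and> v \<notin> ?L}"
      by (auto simp: arcs_ends_conv wellformed' intro: rev_image_eqI)
    then show ?thesis
      using that assms by (auto simp: caterpillar_def is_path_graph_def)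
  qed
  have symG: "(u, v) \<in> parcs G \<Longrightarrow> (v, u) \<in> parcs G" for u v
    using pair_sym_arcs by (auto simp: symmetric_def sym_def)
  have "\<exists>p. \<forall>l\<in>?L. \<forall>v. (l, v) \<in> parcs G \<longleftrightarrow> v = p l"
  proof (rule bchoice, rule ballI)
    fix l assume "l \<in> ?L"
    then have "card {e \<in> parcs G. fst e = l} = 1"
      by (simp add: leaves_def out_degree_def out_arcs_def)
    then obtain e where "{e \<in> parcs G. fst e = l} = {e}" by (auto simp: card_1_singleton_iff)
    then have "f \<in> parcs G \<and> fst f = l \<longleftrightarrow> f = e" for f by blast
    then have "\<forall>v. (l, v) \<in> parcs G \<longleftrightarrow> v = snd e" by (metis fst_conv prod.collapse snd_conv)
    then show "\<exists>q. \<forall>v. (l, v) \<in> parcs G \<longleftrightarrow> v = q" by blast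
  qed
  then obtain p where p: "\<And>l v. l \<in> ?L \<Longrightarrow> (l, v) \<in> parcs G \<longleftrightarrow> v = p l" by blast
  have finL: "finite ?L" using pair_finite_verts by (simp add: leaves_def)
  have LV: "?L \<subseteq> pverts G" by (auto simp: leaves_def)
  have two_leaves: "pverts G = {l, p l}" if "l \<in> ?L" "p l \<in> ?L" for l
  proof -
    have "(l, p l) \<in> parcs G" using p that by blast
    then have pp: "p (p l) = l" by (rule p[OF that(2), THEN iffD1, OF symG, symmetric])
    \<comment> \<open>Two adjacent leaves have no other neighbours, so they form a closed
      set.\<close>
    have "{l, p l} = pverts G"
    proof (rule connected_closed_subset[OF pg conn])
      fix v w assume "(v, w) \<in> parcs G" "v \<in> {l, p l}"
      then show "w \<in> {l, p l}" using p[OF that(1)] p[OF that(2)] pp by auto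
    qed (use that LV in auto)
    then show ?thesis by (rule sym)
  qed
  show ?thesis
  proof (cases "\<exists>l\<in>?L. p l \<in> ?L")
    case True
    then obtain l where l: "l \<in> ?L" "p l \<in> ?L" by blast
    have lp: "(l, p l) \<in> parcs G" by (rule p[OF l(1), THEN iffD2, OF refl])
    then have pl: "(p l, l) \<in> parcs G" by (rule symG)
    have ne: "p l \<noteq> l" using pair_no_loops[OF pl] by simp
    have "e \<in> {(p l, l), (l, p l)}" if "e \<in> parcs G" for e
      using pair_no_loops[OF that] arc_fst_in_verts[OF that] arc_snd_in_verts[OF that]
      unfolding two_leaves[OF l] by (cases e) auto
    then have "parcs G = {} \<union> {(p l, l), (l, p l)}"
      using lp pl by blast
    moreover have "pverts G = insert (p l) {l}" using two_leaves[OF l] by auto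
    ultimately show ?thesis using grown.leaf[OF grown.single, of "p l" l] ne by auto
  next
    case False
    have p_in: "(v, l) \<in> parcs G \<longleftrightarrow> v = p l" if "l \<in> ?L" for v l
      using p[OF that, of v] symG[of v l] symG[of l v] by blast
    have p_xs: "p ` ?L \<subseteq> set xs"
    proof clarify
      fix l assume "l \<in> ?L"
      then have "p l \<in> pverts G" using p in_arcsD2 by blast
      then show "p l \<in> set xs" using False \<open>l \<in> ?L\<close> xs by auto
    qed
    have "pverts G \<noteq> {}" using conn by (simp add: connected_conv)
    \<comment> \<open>With an empty spine every vertex would be a leaf, yet the neighbour of a leaf
      lies on the spine.\<close>
    then have "xs \<noteq> []" using p_xs xs by force
    then have "grown (set xs \<union> ?L)
      (set (vwalk_arcs xs) \<union> (set (vwalk_arcs xs))\<inverse> \<union> {(l, p l) |l. l \<in> ?L} \<union> {(p l, l) |l. l \<in> ?L})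
      (last xs)"
      using xs p_xs finL by (intro grown_spine) auto
    also have "set xs \<union> ?L = pverts G" using xs LV by auto
    also have "set (vwalk_arcs xs) \<union> (set (vwalk_arcs xs))\<inverse> \<union> {(l, p l) |l. l \<in> ?L}
        \<union> {(p l, l) |l. l \<in> ?L} = parcs G"
    proof -
      have "parcs G = {(u, v) \<in> parcs G. u \<notin> ?L \<and> v \<notin> ?L}
          \<union> {(u, v) \<in> parcs G. u \<in> ?L} \<union> {(u, v) \<in> parcs G. v \<in> ?L}"
        by auto
      also have "{(u, v) \<in> parcs G. u \<in> ?L} = {(l, p l) |l. l \<in> ?L}"
        using p by auto
      also have "{(u, v) \<in> parcs G. v \<in> ?L} = {(p l, l) |l. l \<in> ?L}"
        using p_in by auto
      finally show ?thesis unfolding arcs_xs by (rule sym)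
    qed
    finally show ?thesis by blast
  qed
qed

theorem theorem1p4:
  fixes G :: "'a pair_pre_digraph"
  assumes "caterpillar G"
  shows "\<exists>D. is_orientation D G \<and> TAS (with_proj D)"
proof -
  obtain r where "grown (pverts G) (parcs G) r"
    using caterpillar_grown[OF assms] by (rule exE)
  then show ?thesis by (rule grown_TAS_orientation)
qed

end
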